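(* Let $G$ be an outerplanar graph of order $n$. Then $\psi_3(G)\le \frac{n}{2}$.
   Context: Graphs are finite and simple. A subset $S\subseteq V(G)$ is a $3$-path vertex cover of $G$ if every path on $3$ vertices in $G$ contains at least one vertex of $S$; $\psi_3(G)$ denotes the minimum cardinality of a $3$-path vertex cover of $G$. *)

theory Defs
  imports "HOL-Analysis.Analysis" "Graph_Theory.Graph_Theory"
begin

(* Finite simple graphs are the pair_graph structures of Graph_Theory: a finite vertex set
   with a symmetric, irreflexive arc relation, so each edge occurs as two opposite arcs. *)

definition uedges :: "'a pair_pre_digraph \<Rightarrow> 'a set set" where
  "uedges G = {{u, v} |u v. (u, v) \<in> parcs G}"

(* A set of vertices meeting every path of order k, i.e. on k vertices (not of length k). *)
definition path_vertex_cover :: "nat \<Rightarrow> 'a pair_pre_digraph \<Rightarrow> 'a set \<Rightarrow> bool" where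
  "path_vertex_cover k G S \<longleftrightarrow>
     S \<subseteq> pverts G \<and>
     (\<forall>xs. vpath xs (with_proj G) \<and> length xs = k \<longrightarrow> set xs \<inter> S \<noteq> {})"

(* For finite G and k \<ge> 1 the minimum exists, because pverts G itself is a cover. *)
definition psi :: "nat \<Rightarrow> 'a pair_pre_digraph \<Rightarrow> nat" where
  "psi k G = (LEAST m. \<exists>S. path_vertex_cover k G S \<and> card S = m)"

(* Crossing-free drawings in the plane, identified with the complex numbers: pt places the
   vertices, and crv draws each edge as a simple arc joining its ends; the interior of that arc
   contains no vertex and no point of any other edge. *)
definition plane_drawing ::
    "'a pair_pre_digraph \<Rightarrow> ('a \<Rightarrow> complex) \<Rightarrow> ('a set \<Rightarrow> real \<Rightarrow> complex) \<Rightarrow> bool" where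
  "plane_drawing G pt crv \<longleftrightarrow>
     inj_on pt (pverts G) \<and>
     (\<forall>e \<in> uedges G.
        arc (crv e) \<and> {pathstart (crv e), pathfinish (crv e)} = pt ` e \<and>
        (path_image (crv e) - pt ` e) \<inter> pt ` pverts G = {} \<and>
        (\<forall>f \<in> uedges G. f \<noteq> e \<longrightarrow> (path_image (crv e) - pt ` e) \<inter> path_image (crv f) = {}))"

definition drawing_set ::
    "'a pair_pre_digraph \<Rightarrow> ('a \<Rightarrow> complex) \<Rightarrow> ('a set \<Rightarrow> real \<Rightarrow> complex) \<Rightarrow> complex set" where
  "drawing_set G pt crv = pt ` pverts G \<union> (\<Union>e \<in> uedges G. path_image (crv e))"

(* The drawing of a finite graph is compact, so its outside is the single unbounded
   component of its complement, i.e. the outer face. *)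
definition outerplanar :: "'a pair_pre_digraph \<Rightarrow> bool" where
  "outerplanar G \<longleftrightarrow>
     (\<exists>pt crv. plane_drawing G pt crv \<and>
        pt ` pverts G \<subseteq> frontier (outside (drawing_set G pt crv)))"

end

theory Submission
  imports Defs "HOL-Library.Sublist"
begin

text \<open>In a theta curve one of the three arcs runs inside the cycle formed by the other two, so in an
  outerplanar drawing it carries no vertex. Hence the graph contains no three internally disjoint
  paths with common ends and inner vertices, and no cycle has two crossing chords. Splitting at cut
  vertices, and using that a longest cycle of a 2-connected piece is then Hamiltonian, one obtains a
  linear order of the vertices in which no two edges cross. Dynamic programming over intervals of
  this order gives a set of at least half of the vertices inducing maximum degree at most 1;
  its complement is the cover.\<close>

section \<open>Dissociation sets in non-crossing orders\<close>

text \<open>The bare bound of one half does not compose. Adjacent intervals share an end vertex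
  \<open>x\<close>; measured by twice the number of chosen vertices minus the number of inner
  vertices, leaving \<open>x\<close> out costs one and taking it wins one, but taking it requires
  that both sides together give it at most one chosen neighbour. So an interval has to trade surplus
  against what it asks of its ends: kept free of chosen neighbours, chosen themselves, or left out
  without any promise. The order replaces a walk around the outer face, which is never constructed.
  The topology only has to exclude two configurations, and both exclusions rest on one fact: if two
  of three arcs with common ends carry outer vertices in their interiors, the third runs inside
  their cycle. When the third arc carries a vertex this is already a contradiction; when it is a
  chord, two such chords of one cycle are forced into the same disc, where they would have to
  cross.\<close>

definition dissoc :: "('a \<Rightarrow> 'a \<Rightarrow> bool) \<Rightarrow> 'a set \<Rightarrow> bool" where
  "dissoc E A \<longleftrightarrow> (\<forall>x\<in>A. \<forall>y\<in>A. \<forall>z\<in>A. E x y \<longrightarrow> E x z \<longrightarrow> y = z)"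

definition no_edges :: "('a \<Rightarrow> 'a \<Rightarrow> bool) \<Rightarrow> 'a set \<Rightarrow> 'a set \<Rightarrow> bool" where
  "no_edges E A B \<longleftrightarrow> (\<forall>x\<in>A. \<forall>y\<in>B. \<not> E x y \<and> \<not> E y x)"

lemma dissoc_mono: "dissoc E B \<Longrightarrow> A \<subseteq> B \<Longrightarrow> dissoc E A"
  unfolding dissoc_def by blast

lemma dissoc_Un: "dissoc E A \<Longrightarrow> dissoc E B \<Longrightarrow> no_edges E A B \<Longrightarrow> dissoc E (A \<union> B)"
  unfolding dissoc_def no_edges_def by (metis Un_iff)

text \<open>The inequality says that twice the size of \<open>A\<close> exceeds the number
  \<open>j - i - 1\<close> of inner vertices by at least \<open>k\<close>, written without truncated subtraction.\<close>

definition gain :: "(nat \<Rightarrow> nat \<Rightarrow> bool) \<Rightarrow> nat \<Rightarrow> nat \<Rightarrow> nat \<Rightarrow> nat set \<Rightarrow> nat set \<Rightarrow> bool" where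
  "gain E i j k I B \<longleftrightarrow>
     (\<exists>A \<subseteq> {i<..<j}. dissoc E (A \<union> B) \<and> no_edges E I A \<and> j + k \<le> 2 * card A + i + 1)"

lemma gain_mono:
  "gain E i j k I B \<Longrightarrow> k' \<le> k \<Longrightarrow> I' \<subseteq> I \<Longrightarrow> B' \<subseteq> B \<Longrightarrow> gain E i j k' I' B'"
  unfolding gain_def
proof (elim exE conjE)
  fix A assume "A \<subseteq> {i<..<j}" "dissoc E (A \<union> B)" "no_edges E I A" "j + k \<le> 2 * card A + i + 1"
    and "k' \<le> k" "I' \<subseteq> I" "B' \<subseteq> B"
  moreover from this have "dissoc E (A \<union> B')" by (auto intro: dissoc_mono)
  ultimately show "\<exists>A \<subseteq> {i<..<j}. dissoc E (A \<union> B') \<and> no_edges E I' A \<and> j + k' \<le> 2 * card A + i + 1"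
    by (intro exI[of _ A]) (auto simp: no_edges_def)
qed

text \<open>The edge joining \<open>i\<close> and \<open>j\<close> is exempt because it passes over
  every inner vertex when it is present. It can only harm a set that contains both ends, and no
  profile used below asks for that.\<close>

definition splits_at :: "(nat \<Rightarrow> nat \<Rightarrow> bool) \<Rightarrow> nat \<Rightarrow> nat \<Rightarrow> nat \<Rightarrow> bool" where
  "splits_at E i x j \<longleftrightarrow> i < x \<and> x < j \<and>
     (\<forall>p q. i \<le> p \<longrightarrow> p < x \<longrightarrow> x < q \<longrightarrow> q \<le> j \<longrightarrow> (E p q \<or> E q p) \<longrightarrow> p = i \<and> q = j)"

lemma splits_at_no_edges:
  assumes "splits_at E i x j" "A \<subseteq> {i..<x}" "B \<subseteq> {x<..j}" "\<not> (i \<in> A \<and> j \<in> B)"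
  shows "no_edges E A B"
  unfolding no_edges_def
proof (intro ballI)
  fix p q assume p: "p \<in> A" and q: "q \<in> B"
  have "i \<le> p" "p < x" "x < q" "q \<le> j" using assms(2,3) p q by auto
  then show "\<not> E p q \<and> \<not> E q p"
    using assms(1,4) p q unfolding splits_at_def by blast
qed

text \<open>With \<open>x\<close> left out, \<open>x\<close> is one more inner vertex that
  contributes nothing, so the surpluses add up to \<open>k1 + k2 - 1\<close>. No edge passes over
  \<open>x\<close> except possibly the one between the two ends, so the two halves cannot disturb
  each other.\<close>

lemma gain_out:
  assumes s: "splits_at E i x j" and "gain E i x k1 IL BL" "gain E x j k2 IR BR"
    and I: "I \<subseteq> (IL \<inter> {i}) \<union> (IR \<inter> {j})" and B: "B \<subseteq> (BL \<inter> {i}) \<union> (BR \<inter> {j})"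
    and "\<not> (i \<in> B \<and> j \<in> B)" and "k + 1 \<le> k1 + k2"
  shows "gain E i j k I B"
proof -
  obtain L R where L: "L \<subseteq> {i<..<x}" "dissoc E (L \<union> BL)" "no_edges E IL L" "x + k1 \<le> 2 * card L + i + 1"
    and R: "R \<subseteq> {x<..<j}" "dissoc E (R \<union> BR)" "no_edges E IR R" "j + k2 \<le> 2 * card R + x + 1"
    using assms(2,3) unfolding gain_def by blast
  have ij: "i < x" "x < j" using s by (auto simp: splits_at_def)
  have c: "card (L \<union> R) = card L + card R"
  proof -
    have "finite L" "finite R" using L(1) R(1) finite_subset by blast+
    moreover have "L \<inter> R = {}" using L(1) R(1) by fastforce
    ultimately show ?thesis by (rule card_Un_disjoint)
  qed
  have "no_edges E (L \<union> (B \<inter> {i})) (R \<union> (B \<inter> {j}))"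
    using L(1) R(1) ij assms(6) by (intro splits_at_no_edges[OF s]) auto
  moreover have "dissoc E (L \<union> (B \<inter> {i}))" using B ij by (intro dissoc_mono[OF L(2)]) auto
  moreover have "dissoc E (R \<union> (B \<inter> {j}))" using B ij by (intro dissoc_mono[OF R(2)]) auto
  ultimately have "dissoc E ((L \<union> (B \<inter> {i})) \<union> (R \<union> (B \<inter> {j})))" by (rule dissoc_Un[rotated 2])
  then have d: "dissoc E ((L \<union> R) \<union> B)" by (rule dissoc_mono) (use B in auto)
  have "no_edges E I (L \<union> R)"
    unfolding no_edges_def
  proof (intro ballI)
    fix p q assume p: "p \<in> I" and q: "q \<in> L \<union> R"
    have "no_edges E L {j}" "no_edges E {i} R"
      using L(1) R(1) ij by (intro splits_at_no_edges[OF s]; auto)+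
    then show "\<not> E p q \<and> \<not> E q p"
      using p q I L(3) R(3) unfolding no_edges_def by blast
  qed
  moreover have "L \<union> R \<subseteq> {i<..<j}" using L(1) R(1) ij by auto
  moreover have "j + k \<le> 2 * card (L \<union> R) + i + 1" using c L(4) R(4) assms(7) by linarith
  ultimately show ?thesis unfolding gain_def using d by blast
qed

text \<open>Taking \<open>x\<close> adds two to twice the size and one to the inner vertices, hence
  \<open>k1 + k2 + 1\<close>. The alternatives are the ways to give \<open>x\<close> at most one
  chosen neighbour: one on the right, one on the left, none, or the end \<open>j\<close> or
  \<open>i\<close>, which must then have no other. No end is promised to stay isolated afterwards,
  since \<open>x\<close> may be adjacent to both.\<close>

lemma gain_in:
  assumes s: "splits_at E i x j" and "gain E i x k1 IL BL" "gain E x j k2 IR BR"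
    and irr: "\<And>p. \<not> E p p" 
    and B: "x \<in> IL \<and> x \<in> BR \<and> B = {} \<or> x \<in> BL \<and> x \<in> IR \<and> B = {} \<or>
       x \<in> IL \<and> x \<in> IR \<and> B = {} \<or>
       x \<in> IL \<and> x \<in> IR \<and> j \<in> IR \<and> B = {j} \<or> x \<in> IL \<and> x \<in> IR \<and> i \<in> IL \<and> B = {i}" 
    and "k \<le> k1 + k2 + 1"
  shows "gain E i j k {} B"
proof -
  obtain L R where L: "L \<subseteq> {i<..<x}" "dissoc E (L \<union> BL)" "no_edges E IL L" "x + k1 \<le> 2 * card L + i + 1"
    and R: "R \<subseteq> {x<..<j}" "dissoc E (R \<union> BR)" "no_edges E IR R" "j + k2 \<le> 2 * card R + x + 1"
    using assms(2,3) unfolding gain_def by blast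
  have ij: "i < x" "x < j" using s by (auto simp: splits_at_def)
  have c: "card (insert x (L \<union> R)) = card L + card R + 1"
  proof -
    have "finite L" "finite R" using L(1) R(1) finite_subset by blast+
    moreover have "L \<inter> R = {}" "x \<notin> L \<union> R" using L(1) R(1) by fastforce+
    ultimately show ?thesis by (simp add: card_Un_disjoint)
  qed
  have LR: "no_edges E L R" "no_edges E L {j}" "no_edges E {i} R"
    using L(1) R(1) ij by (intro splits_at_no_edges[OF s]; auto)+
  have L': "dissoc E L" and R': "dissoc E R" using L(2) R(2) by (auto intro: dissoc_mono)
  have d: "dissoc E ((insert x (L \<union> R)) \<union> B)"
    using B
  proof (elim disjE conjE)
    assume *: "x \<in> IL" "x \<in> BR" "B = {}"
    have "dissoc E (insert x R)" by (rule dissoc_mono[OF R(2)]) (use * in auto)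
    moreover have "no_edges E L (insert x R)" using LR L(3) * unfolding no_edges_def by auto
    ultimately have "dissoc E (L \<union> insert x R)" using dissoc_Un L' by metis
    then show ?thesis using * by simp
  next
    assume *: "x \<in> BL" "x \<in> IR" "B = {}"
    have "dissoc E (insert x L)" by (rule dissoc_mono[OF L(2)]) (use * in auto)
    moreover have "no_edges E (insert x L) R" using LR R(3) * unfolding no_edges_def by auto
    ultimately have "dissoc E (insert x L \<union> R)" using dissoc_Un R' by metis
    then show ?thesis using * by simp
  next
    assume *: "x \<in> IL" "x \<in> IR" "B = {}"
    have "dissoc E {x}" by (auto simp: dissoc_def)
    moreover have "dissoc E (L \<union> R)" using dissoc_Un L' R' LR by metis
    moreover have "no_edges E (L \<union> R) {x}" using L(3) R(3) * unfolding no_edges_def by auto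
    ultimately have "dissoc E ((L \<union> R) \<union> {x})" using dissoc_Un by metis
    then show ?thesis using * by simp
  next
    assume *: "x \<in> IL" "x \<in> IR" "j \<in> IR" "B = {j}"
    have "dissoc E {x, j}" using irr by (auto simp: dissoc_def)
    moreover have "dissoc E (L \<union> R)" using dissoc_Un L' R' LR by metis
    moreover have "no_edges E (L \<union> R) {x, j}" using LR L(3) R(3) * unfolding no_edges_def by auto
    ultimately have "dissoc E ((L \<union> R) \<union> {x, j})" using dissoc_Un by metis
    then show ?thesis using * by (simp add: insert_commute)
  next
    assume *: "x \<in> IL" "x \<in> IR" "i \<in> IL" "B = {i}"
    have "dissoc E {x, i}" using irr by (auto simp: dissoc_def)
    moreover have "dissoc E (L \<union> R)" using dissoc_Un L' R' LR by metis
    moreover have "no_edges E (L \<union> R) {x, i}" using LR L(3) R(3) * unfolding no_edges_def by auto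
    ultimately have "dissoc E ((L \<union> R) \<union> {x, i})" using dissoc_Un by metis
    then show ?thesis using * by (simp add: insert_commute)
  qed
  have "insert x (L \<union> R) \<subseteq> {i<..<j}" using L(1) R(1) ij by auto
  moreover have "j + k \<le> 2 * card (insert x (L \<union> R)) + i + 1" using c L(4) R(4) assms(6) by linarith
  ultimately show ?thesis unfolding gain_def using d by (intro exI[of _ "insert x (L \<union> R)"]) (auto simp: no_edges_def)
qed

text \<open>The five alternatives are the Pareto-minimal gain profiles that arise from composing
  intervals, when profiles are cut off below \<open>0\<close>; this is why the disjunction is closed
  under composition.\<close>

definition good_interval :: "(nat \<Rightarrow> nat \<Rightarrow> bool) \<Rightarrow> nat \<Rightarrow> nat \<Rightarrow> bool" where
  "good_interval E i j \<longleftrightarrow> gain E i j 0 {i, j} {} \<or> gain E i j 1 {i} {} \<or> gain E i j 1 {j} {} \<or>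
     (gain E i j 1 {} {i} \<and> gain E i j 1 {} {j}) \<or> gain E i j 2 {} {}"

lemma good_interval_cases [consumes 1, case_names both left right single none]:
  assumes "good_interval E i j"
  obtains "gain E i j 0 {i, j} {}" | "gain E i j 1 {i} {}" | "gain E i j 1 {j} {}"
    | "gain E i j 1 {} {i}" "gain E i j 1 {} {j}" | "gain E i j 2 {} {}"
  using assms unfolding good_interval_def by blast

text \<open>The 25 cases follow one rule: \<open>x\<close> is taken exactly when one side keeps it
  isolated and the other side either keeps it isolated too or can have it chosen. Otherwise
  \<open>x\<close> is dropped.\<close>

lemma good_interval_compose:
  assumes s: "splits_at E i x j" and irr: "\<And>p. \<not> E p p" and l: "good_interval E i x" and r: "good_interval E x j"
  shows "good_interval E i j"
proof -
  have ij: "i < x" "x < j" using s by (auto simp: splits_at_def)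
  note out = gain_out[OF s] and inn = gain_in[OF s _ _ irr]
  have A: "gain E i j 0 {i, j} {} \<Longrightarrow> ?thesis"
    and B: "gain E i j 1 {i} {} \<Longrightarrow> ?thesis"
    and D: "gain E i j 1 {j} {} \<Longrightarrow> ?thesis"
    and C: "gain E i j 1 {} {i} \<Longrightarrow> gain E i j 1 {} {j} \<Longrightarrow> ?thesis"
    and E: "gain E i j 2 {} {} \<Longrightarrow> ?thesis"
    unfolding good_interval_def by blast+
  from l show ?thesis
  proof (cases rule: good_interval_cases)
    case L: both
    from r show ?thesis
    proof (cases rule: good_interval_cases)
      \<comment> \<open>This is where the profile \<open>single\<close> originates: \<open>x\<close>
        is isolated on both sides, so it can be paired with either end, but not with both at
        once.\<close>
      case both show ?thesis by (rule C; rule inn[OF L both]; simp)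
    next
      case left show ?thesis by (rule E, rule inn[OF L left]) auto
    next
      case right show ?thesis by (rule A, rule out[OF L right]) auto
    next
      case single show ?thesis by (rule E, rule inn[OF L single(1)]) auto
    next
      case none show ?thesis by (rule B, rule out[OF L none]) auto
    qed
  next
    case L: left
    from r show ?thesis
    proof (cases rule: good_interval_cases)
      case both show ?thesis by (rule A, rule out[OF L both]) auto
    next
      case left show ?thesis by (rule B, rule out[OF L left]) auto
    next
      case right show ?thesis by (rule A, rule out[OF L right]) auto
    next
      case single show ?thesis by (rule B, rule out[OF L single(1)]) auto
    next
      case none show ?thesis by (rule B, rule out[OF L none]) auto
    qed
  next
    case L: right
    from r show ?thesis
    proof (cases rule: good_interval_cases)
      case both show ?thesis by (rule E, rule inn[OF L both]) auto
    next
      case left show ?thesis by (rule E, rule inn[OF L left]) auto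
    next
      case right show ?thesis by (rule D, rule out[OF L right]) auto
    next
      case single show ?thesis by (rule E, rule inn[OF L single(1)]) auto
    next
      case none show ?thesis by (rule E, rule out[OF L none]) auto
    qed
  next
    case L: single
    from r show ?thesis
    proof (cases rule: good_interval_cases)
      case both show ?thesis by (rule E, rule inn[OF L(2) both]) auto
    next
      case left show ?thesis by (rule E, rule inn[OF L(2) left]) auto
    next
      case right show ?thesis by (rule D, rule out[OF L(1) right]) auto
    next
      case single
      \<comment> \<open>Both sides could hold \<open>x\<close>, but together they might give it two
        neighbours. Dropping it, one choice of inner vertices works with \<open>i\<close> added and
        also with \<open>j\<close> added.\<close>
      show ?thesis by (rule C; (rule out[OF L(1) single(2)]; use ij in auto))
    next
      case none show ?thesis by (rule E, rule out[OF L(1) none]) auto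
    qed
  next
    case L: none
    from r show ?thesis
    proof (cases rule: good_interval_cases)
      case both show ?thesis by (rule D, rule out[OF L both]) auto
    next
      case left show ?thesis by (rule E, rule out[OF L left]) auto
    next
      case right show ?thesis by (rule E, rule out[OF L right]) auto
    next
      case single show ?thesis by (rule E, rule out[OF L single(1)]) auto
    next
      case none show ?thesis by (rule E, rule out[OF L none]) auto
    qed
  qed
qed

lemma noncrossing_good_interval:
  assumes sym: "symp E" and irr: "\<And>p. \<not> E p p"
    and nc: "\<And>a b c d. a < b \<Longrightarrow> b < c \<Longrightarrow> c < d \<Longrightarrow> E a c \<Longrightarrow> E b d \<Longrightarrow> False"
    and "i < j"
  shows "good_interval E i j"
  using \<open>i < j\<close>
proof (induction "j - i" arbitrary: i j rule: less_induct)
  case less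
  show ?case
  proof (cases "j = Suc i")
    case True
    then have "gain E i j 0 {i, j} {}" by (auto simp: gain_def dissoc_def no_edges_def)
    then show ?thesis by (simp add: good_interval_def)
  next
    case False
    \<comment> \<open>Splitting at the last inner neighbour of \<open>i\<close>, no edge but \<open>{i, j}\<close> can pass over \<open>x\<close>.\<close>
    define N where "N = insert (Suc i) {x. i < x \<and> x < j \<and> E i x}"
    define x where "x = Max N"
    have fin: "finite N" unfolding N_def by simp
    have "x \<in> N" unfolding x_def by (rule Max_in) (auto simp: N_def)
    have mx: "y \<le> x" if "y \<in> N" for y unfolding x_def using fin that by simp
    have x: "i < x" "x < j" using \<open>x \<in> N\<close> False less.prems by (auto simp: N_def)
    have "p = i \<and> q = j" if pq: "i \<le> p" "p < x" "x < q" "q \<le> j" "E p q" for p q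
    proof (cases "p = i")
      case True
      have "q \<notin> N" using mx[of q] pq(3) by auto
      then show ?thesis using True pq x(1) by (auto simp: N_def)
    next
      case False
      \<comment> \<open>A vertex \<open>p\<close> strictly between \<open>i\<close> and
        \<open>x\<close> rules out the default \<open>Suc i\<close>, so \<open>x\<close> really is a
        neighbour of \<open>i\<close>, and an edge from \<open>p\<close> over \<open>x\<close> would
        cross that edge.\<close>
      then have "E i x" using \<open>x \<in> N\<close> pq by (auto simp: N_def)
      then show ?thesis using nc[of i p x q] False pq by force
    qed
    then have "splits_at E i x j" using x sym unfolding splits_at_def by (meson sympD)
    then show ?thesis
      by (rule good_interval_compose) (use irr less x in auto)
  qed
qed

lemma noncrossing_dissoc:
  assumes "symp E" "\<And>p. \<not> E p p"
    and "\<And>a b c d. a < b \<Longrightarrow> b < c \<Longrightarrow> c < d \<Longrightarrow> E a c \<Longrightarrow> E b d \<Longrightarrow> False"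
  shows "\<exists>A \<subseteq> {0<..<Suc n}. dissoc E A \<and> n \<le> 2 * card A"
proof -
  \<comment> \<open>The sentinels \<open>0\<close> and \<open>Suc n\<close> are not counted, so every alternative of a good interval suffices.\<close>
  have "good_interval E 0 (Suc n)" by (rule noncrossing_good_interval) (use assms in auto)
  then have "gain E 0 (Suc n) 0 {} {}" unfolding good_interval_def by (auto elim: gain_mono)
  then show ?thesis unfolding gain_def by auto
qed

section \<open>Existence of a non-crossing order\<close>

definition noncrossing :: "('a \<Rightarrow> 'a \<Rightarrow> bool) \<Rightarrow> 'a list \<Rightarrow> bool" where
  "noncrossing E vs \<longleftrightarrow> (\<forall>a b c d. subseq [a, b, c, d] vs \<longrightarrow> \<not> (E a c \<and> E b d))"

text \<open>Crossing is a cyclic notion. Only the last of the four vertices can be the moved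
  \<open>x\<close>; put back in front, it gives the crossing quadruple \<open>[x, a, b, c]\<close>
  with the two edges exchanged.\<close>

lemma noncrossing_rotate1:
  assumes "symp E" "noncrossing E (x # ys)"
  shows "noncrossing E (ys @ [x])"
  unfolding noncrossing_def
proof (intro allI impI notI)
  fix a b c d assume s: "subseq [a, b, c, d] (ys @ [x])" and e: "E a c \<and> E b d"
  obtain us ws where uw: "[a, b, c, d] = us @ ws" "subseq us ys" "subseq ws [x]"
    using s unfolding subseq_append_iff by blast
  have "length ws \<le> 1" using list_emb_length[OF uw(3)] by simp
  then have "ws = [] \<or> ws = [d]" using uw(1)
    by (cases ws rule: rev_cases) (auto simp: append_eq_Cons_conv)
  then show False
  proof
    assume "ws = []"
    then have "subseq [a, b, c, d] (x # ys)" using uw by (auto intro: list_emb_Cons)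
    then show False using assms(2) e by (auto simp: noncrossing_def)
  next
    assume "ws = [d]"
    then have "us = [a, b, c]" "d = x" using uw by (auto split: if_splits)
    then have "subseq [x, a, b, c] (x # ys)" using uw by auto
    then show False using assms e \<open>d = x\<close> unfolding noncrossing_def by (meson sympD)
  qed
qed

lemma noncrossing_rotate:
  assumes "symp E" "noncrossing E (xs @ ys)"
  shows "noncrossing E (ys @ xs)"
  using assms(2)
proof (induction xs arbitrary: ys)
  case (Cons x xs)
  then show ?case using noncrossing_rotate1[OF assms(1), of x "xs @ ys"] Cons.IH[of "ys @ [x]"] by simp
qed simp

text \<open>This joins the orders of two pieces at a cut vertex \<open>v\<close>. A crossing
  quadruple that lies in neither piece has one of its two edges running from \<open>xs\<close> to
  \<open>ys\<close>; counting how many of the four vertices fall into \<open>xs\<close> tells which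
  one.\<close>

lemma noncrossing_glue:
  assumes "noncrossing E (xs @ [v])" "noncrossing E (v # ys)"
    and no: "\<And>x y. x \<in> set xs \<Longrightarrow> y \<in> set ys \<Longrightarrow> \<not> E x y"
  shows "noncrossing E (xs @ v # ys)"
  unfolding noncrossing_def
proof (intro allI impI notI)
  fix a b c d assume s: "subseq [a, b, c, d] (xs @ v # ys)" and e: "E a c \<and> E b d"
  obtain us ws where uw: "[a, b, c, d] = us @ ws" "subseq us xs" "subseq ws (v # ys)"
    using s unfolding subseq_append_iff by blast
  \<comment> \<open>Only the first entry of \<open>ws\<close> can be \<open>v\<close>; all later
    ones lie strictly in \<open>ys\<close>.\<close>
  have tl: "set (tl ws) \<subseteq> set ys"
    using uw(3) by (cases ws) (auto dest: subseq_Cons' list_emb_set split: if_splits)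
  have us: "set us \<subseteq> set xs" using uw(2) by (auto dest: list_emb_set)
  consider "us = []" "ws = [a, b, c, d]" | "us = [a]" "ws = [b, c, d]" | "us = [a, b]" "ws = [c, d]"
    | "us = [a, b, c]" "ws = [d]" | "us = [a, b, c, d]" "ws = []"
  proof -
    have "length us \<le> 4" using arg_cong[OF uw(1), of length] by simp
    then have "length us = 0 \<or> length us = 1 \<or> length us = 2 \<or> length us = 3 \<or> length us = 4" by linarith
    moreover have "us = take (length us) [a, b, c, d]" "ws = drop (length us) [a, b, c, d]"
      using uw(1) by simp_all
    ultimately show thesis using that by (auto simp: eval_nat_numeral)
  qed
  then show False
  proof cases
    case 1 then show False using assms(2) uw(3) e unfolding noncrossing_def by blast
  next
    case 2 then show False using no[of a c] tl us e by simp
  next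
    case 3 then show False using no[of b d] tl us e by simp
  next
    case 4
    show False
    proof (cases "d = v")
      case True
      then have "subseq [a, b, c, d] (xs @ [v])"
        using uw(2) 4 list_emb_append_mono[of "(=)" us xs "[d]" "[v]"] by simp
      then show False using assms(1) e unfolding noncrossing_def by blast
    next
      case False
      then have "d \<in> set ys" using uw(3) 4 by (auto dest: list_emb_set)
      then show False using no[of b d] us 4 e by simp
    qed
  next
    case 5
    then have "subseq [a, b, c, d] (xs @ [v])" using uw(2) by auto
    then show False using assms(1) e unfolding noncrossing_def by blast
  qed
qed

definition cycle_list :: "('a \<Rightarrow> 'a \<Rightarrow> bool) \<Rightarrow> 'a list \<Rightarrow> bool" where
  "cycle_list E c \<longleftrightarrow> distinct c \<and> 2 \<le> length c \<and> successively E c \<and> E (last c) (hd c)"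

lemma cycle_list_rotate:
  assumes "cycle_list E (xs @ ys)"
  shows "cycle_list E (ys @ xs)"
proof (cases "xs = [] \<or> ys = []")
  case True
  then show ?thesis using assms by auto
next
  case False
  then show ?thesis using assms by (auto simp: cycle_list_def successively_append_iff)
qed

text \<open>Connectedness is stated through bipartitions, so the proof takes the set of ends of
  paths from \<open>x\<close> that avoid \<open>T\<close> and looks at an edge leaving it. Its far
  end must be in \<open>T\<close>: otherwise a prefix or an extension of the path would put that end
  into the set.\<close>

lemma ex_path_to:
  assumes conn: "\<And>X Y. X \<union> Y = U \<Longrightarrow> X \<inter> Y = {} \<Longrightarrow> X \<noteq> {} \<Longrightarrow> Y \<noteq> {} \<Longrightarrow> \<exists>a\<in>X. \<exists>b\<in>Y. E a b"
    and "x \<in> U" "x \<notin> T" "T \<subseteq> U" "T \<noteq> {}"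
  shows "\<exists>p w. w \<in> T \<and> p \<noteq> [] \<and> hd p = x \<and> distinct p \<and> set p \<subseteq> U - T \<and> successively E (p @ [w])"
proof -
  define Q where "Q p \<longleftrightarrow> p \<noteq> [] \<and> hd p = x \<and> distinct p \<and> set p \<subseteq> U - T \<and> successively E p" for p
  define X where "X = {last p |p. Q p}"
  have "Q [x]" using assms by (auto simp: Q_def)
  then have "x \<in> X" unfolding X_def by force
  have "X \<subseteq> U - T" unfolding X_def Q_def using last_in_set by blast
  then obtain a b where ab: "a \<in> X" "b \<in> U - X" "E a b"
    using conn[of X "U - X"] \<open>x \<in> X\<close> assms(4,5) by blast
  obtain p where p: "Q p" "a = last p" using ab(1) unfolding X_def by blast
  have s: "successively E (p @ [b])" using p ab(3) by (auto simp: Q_def successively_append_iff)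
  have "b \<in> T"
  proof (rule ccontr)
    assume b: "b \<notin> T"
    have "b \<notin> set p"
    proof
      assume "b \<in> set p"
      then obtain p1 p2 where "p = p1 @ b # p2" by (meson split_list)
      then have "Q (p1 @ [b])" using p(1) by (auto simp: Q_def successively_append_iff hd_append)
      then have "b \<in> X" unfolding X_def by force
      then show False using ab by simp
    qed
    then have "Q (p @ [b])" using p(1) s b ab(2) by (auto simp: Q_def)
    then have "b \<in> X" unfolding X_def by force
    then show False using ab by simp
  qed
  then show ?thesis using p(1) s by (intro exI[of _ p] exI[of _ b]) (simp add: Q_def)
qed

text \<open>For symmetric \<open>E\<close> this is a subdivision of \<open>K_{2,3}\<close>. Each of
  the three paths must have an inner vertex, because a cycle with a chord is a theta that
  outerplanar graphs do contain.\<close>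

definition theta_paths :: "('a \<Rightarrow> 'a \<Rightarrow> bool) \<Rightarrow> 'a \<Rightarrow> 'a \<Rightarrow> 'a list \<Rightarrow> 'a list \<Rightarrow> 'a list \<Rightarrow> bool" where
  "theta_paths E u w p q r \<longleftrightarrow> p \<noteq> [] \<and> q \<noteq> [] \<and> r \<noteq> [] \<and> distinct (u # w # p @ q @ r) \<and>
     successively E (u # p @ [w]) \<and> successively E (u # q @ [w]) \<and> successively E (u # r @ [w])"

lemma successively_rev_symp:
  assumes "symp E" "successively E xs"
  shows "successively E (rev xs)"
  using successively_mono[OF assms(2), of "\<lambda>x y. E y x"] sympD[OF assms(1)] by simp

text \<open>If \<open>u\<close> and \<open>w\<close> are consecutive on the cycle, the ear replaces
  the edge between them and lengthens the cycle. If they are not, the two sides of the cycle and the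
  ear form a theta.\<close>

lemma cycle_list_ear:
  assumes "symp E" and c: "cycle_list E (u # p @ w # q)"
    and r: "r \<noteq> []" "distinct r" "set r \<inter> set (u # p @ w # q) = {}" "successively E (u # r @ [w])"
    and noth: "\<not> theta_paths E u w p (rev q) r"
  shows "\<exists>c'. cycle_list E c' \<and> set c' \<subseteq> set (u # p @ w # q) \<union> set r \<and> length (u # p @ w # q) < length c'"
proof -
  have rl: "0 < length r" using r by simp
  consider "p = []" | "q = []" | "p \<noteq> []" "q \<noteq> []" by blast
  then show ?thesis
  proof cases
    case 1
    then have "cycle_list E (u # r @ w # q)"
      using c r by (auto simp: cycle_list_def successively_Cons successively_append_iff)
    then show ?thesis using 1 rl by (intro exI[of _ "u # r @ w # q"]) auto
  next
    case 2
    have wr: "successively E (w # rev r @ [u])"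
      using r(4) successively_rev_symp[OF assms(1), of "u # r @ [w]"] by simp
    have "cycle_list E (u # p @ w # rev r)"
      using c r wr 2 by (auto simp: cycle_list_def successively_Cons successively_append_iff last_rev hd_rev hd_append split: if_splits)
    then show ?thesis using 2 rl by (intro exI[of _ "u # p @ w # rev r"]) auto
  next
    case 3
    have "successively E (w # q @ [u])"
      using c 3 by (auto simp: cycle_list_def successively_Cons successively_append_iff)
    then have "successively E (u # rev q @ [w])"
      using successively_rev_symp[OF assms(1), of "w # q @ [u]"] by simp
    then have "theta_paths E u w p (rev q) r"
      using c r 3 by (auto simp: theta_paths_def cycle_list_def successively_Cons successively_append_iff)
    then show ?thesis using noth by simp
  qed
qed

text \<open>Both hypotheses concern configurations within \<open>V\<close> and so pass to subsets;
  this lets the induction treat the two pieces at a cut vertex, which overlap in that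
  vertex.\<close>

lemma ex_noncrossing_order:
  assumes "finite V" "symp E"
    and "\<And>u w p q r. set (u # w # p @ q @ r) \<subseteq> V \<Longrightarrow> \<not> theta_paths E u w p q r"
    and "\<And>c. set c \<subseteq> V \<Longrightarrow> cycle_list E c \<Longrightarrow> noncrossing E c"
  shows "\<exists>vs. distinct vs \<and> set vs = V \<and> noncrossing E vs"
  using assms(1,3,4)
proof (induction "card V" arbitrary: V rule: less_induct)
  case less
  show ?case
  proof (cases "\<exists>v X Y. v \<in> V \<and> X \<union> Y = V - {v} \<and> X \<inter> Y = {} \<and> X \<noteq> {} \<and> Y \<noteq> {} \<and> (\<forall>a\<in>X. \<forall>b\<in>Y. \<not> E a b)")
    \<comment> \<open>A disconnected \<open>V\<close> with at least three vertices also falls under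
      this case: removing a vertex from a side that has more than one leaves two nonempty sides. No
      separate treatment of components is needed.\<close>
    case True
    then obtain v X Y where v: "v \<in> V" "X \<union> Y = V - {v}" "X \<inter> Y = {}" "X \<noteq> {}" "Y \<noteq> {}"
      and no: "\<forall>a\<in>X. \<forall>b\<in>Y. \<not> E a b" by blast
    have nv: "v \<notin> X" "v \<notin> Y" using v(2) by auto
    obtain x y where "x \<in> X" "y \<in> Y" using v(4,5) by blast
    then have "x \<in> V - insert v Y" "y \<in> V - insert v X" using v(2,3) nv by auto
    moreover have "insert v X \<subseteq> V" "insert v Y \<subseteq> V" using v(1,2) by auto
    ultimately have sub: "insert v X \<subset> V" "insert v Y \<subset> V" by auto
    have IH: "\<exists>vs. distinct vs \<and> set vs = W \<and> noncrossing E vs" if "W \<subset> V" for W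
    proof (rule less.hyps)
      show "card W < card V" "finite W"
        using psubset_card_mono[OF less.prems(1) that] finite_subset[OF psubset_imp_subset[OF that] less.prems(1)]
        by blast+
      show "\<And>u w p q r. set (u # w # p @ q @ r) \<subseteq> W \<Longrightarrow> \<not> theta_paths E u w p q r"
        by (rule less.prems(2)) (use that in auto)
      show "\<And>c. set c \<subseteq> W \<Longrightarrow> cycle_list E c \<Longrightarrow> noncrossing E c"
        by (rule less.prems(3)) (use that in auto)
    qed
    obtain xs where xs: "distinct xs" "set xs = insert v X" "noncrossing E xs"
      using IH[OF sub(1)] by blast
    obtain ys where ys: "distinct ys" "set ys = insert v Y" "noncrossing E ys"
      using IH[OF sub(2)] by blast
    obtain x1 x2 where x12: "xs = x1 @ v # x2" using split_list[of v xs] unfolding xs(2) by blast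
    obtain y1 y2 where y12: "ys = y1 @ v # y2" using split_list[of v ys] unfolding ys(2) by blast
    have X: "set (x2 @ x1) = X" and Y: "set (y2 @ y1) = Y"
    proof -
      have "set (x2 @ x1) = set xs - {v}" "set (y2 @ y1) = set ys - {v}"
        using xs(1) ys(1) unfolding x12 y12 by auto
      then show "set (x2 @ x1) = X" "set (y2 @ y1) = Y" using xs(2) ys(2) nv by auto
    qed
    \<comment> \<open>The orders of the pieces are rotated until \<open>v\<close> is last in one and
      first in the other.\<close>
    have "noncrossing E ((x2 @ x1) @ v # (y2 @ y1))"
    proof (rule noncrossing_glue)
      show "noncrossing E ((x2 @ x1) @ [v])"
        using noncrossing_rotate[OF assms(2), of "x1 @ [v]" x2] xs(3) x12 by simp
      show "noncrossing E (v # (y2 @ y1))"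
        using noncrossing_rotate[OF assms(2), of y1 "v # y2"] ys(3) y12 by simp
      show "\<not> E x y" if "x \<in> set (x2 @ x1)" "y \<in> set (y2 @ y1)" for x y
        using that no unfolding X Y by blast
    qed
    moreover have "distinct ((x2 @ x1) @ v # (y2 @ y1))"
    proof -
      have "distinct (x2 @ x1)" "distinct (y2 @ y1)" using xs(1) ys(1) unfolding x12 y12 by auto
      then show ?thesis using nv v(3)
        unfolding distinct_append[of "x2 @ x1" "v # (y2 @ y1)"] distinct.simps(2) list.set(2) X Y by simp
    qed
    moreover have "set ((x2 @ x1) @ v # (y2 @ y1)) = V" using X Y v(1,2) by auto
    ultimately show ?thesis by blast
  next
    case False
    have conn: "\<exists>a\<in>X. \<exists>b\<in>Y. E a b"
      if "v \<in> V" "X \<union> Y = V - {v}" "X \<inter> Y = {}" "X \<noteq> {}" "Y \<noteq> {}" for v X Y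
    proof (rule ccontr)
      assume "\<not> ?thesis"
      then have "\<forall>a\<in>X. \<forall>b\<in>Y. \<not> E a b" by simp
      show False
        by (rule notE[OF False], intro exI[of _ v] exI[of _ X] exI[of _ Y] conjI) fact+
    qed
    show ?thesis
    proof (cases "card V \<le> 2")
      case True
      obtain vs where vs: "set vs = V" "distinct vs" using finite_distinct_list[OF less.prems(1)] by blast
      then have "length vs \<le> 2" using True distinct_card by fastforce
      then have "noncrossing E vs" unfolding noncrossing_def by (auto dest: list_emb_length)
      then show ?thesis using vs by blast
    next
      case False
      define P where "P c \<longleftrightarrow> cycle_list E c \<and> set c \<subseteq> V" for c
      have len: "length c \<le> card V" if "P c" for c
        using that less.prems(1) distinct_card[of c] card_mono[of V "set c"] by (auto simp: P_def cycle_list_def)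
      have "3 \<le> card V" using False by simp
      then obtain T where T: "T \<subseteq> V" "card T = 3" using obtain_subset_with_card_n[of 3 V] by metis
      obtain v u x where "T = {v, u, x}" "v \<noteq> u" "v \<noteq> x" "u \<noteq> x"
        using T(2) unfolding card_3_iff by blast
      then have vux: "v \<in> V" "u \<in> V" "v \<noteq> u" "x \<in> V - {v} - {u}" using T(1) by auto
      obtain y where y: "y \<in> V - {v} - {u}" "E u y" using conn[of v "{u}" "V - {v} - {u}"] vux by (auto simp: insert_absorb)
      \<comment> \<open>A single edge starts the search; lengths are bounded by
        \<open>card V\<close>, so a longest cycle exists.\<close>
      then have "P [u, y]" using vux sympD[OF assms(2)] by (auto simp: P_def cycle_list_def)
      then have "\<exists>c. P c \<and> (\<forall>c'. P c' \<longrightarrow> length c' \<le> length c)"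
        using len by (intro ex_has_greatest_nat[of P "[u, y]" length "Suc (card V)"]) (simp_all add: less_Suc_eq_le)
      then obtain c where c: "P c" and mx: "\<And>c'. P c' \<Longrightarrow> length c' \<le> length c" by blast
      \<comment> \<open>Otherwise the longest cycle has an ear, which lengthens it or yields a theta.\<close>
      have "set c = V"
      proof (rule ccontr)
        assume "set c \<noteq> V"
        then have ne: "V - set c \<noteq> {}" "set c \<subseteq> V" using c by (auto simp: P_def)
        obtain v y ys where "c = v # y # ys"
          using c by (auto simp: P_def cycle_list_def numeral_2_eq_2 Suc_le_length_iff)
        then have v: "v \<in> set c" "set c - {v} \<noteq> {}" using c by (auto simp: P_def cycle_list_def)
        \<comment> \<open>Deleting a vertex \<open>v\<close> of the cycle leaves a connected set,
          which provides an edge leaving the cycle. The cycle has another vertex left because its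
          length is at least two.\<close>
        have "(set c - {v}) \<union> (V - set c) = V - {v}" using v ne by auto
        then obtain u x where ux: "u \<in> set c - {v}" "x \<in> V - set c" "E u x"
          using conn[of v "set c - {v}" "V - set c"] v ne by blast
        have tgt: "set c - {u} \<noteq> {}" using v ux by auto
        have "u \<in> V" using ux ne by auto
        \<comment> \<open>Now \<open>u\<close> itself is deleted, so that the path from
          \<open>x\<close> returns to the cycle at some \<open>w\<close> other than \<open>u\<close>
          and forms a genuine ear.\<close>
        have "\<exists>r w. w \<in> set c - {u} \<and> r \<noteq> [] \<and> hd r = x \<and> distinct r \<and>
          set r \<subseteq> (V - {u}) - (set c - {u}) \<and> successively E (r @ [w])"
        proof (rule ex_path_to)
          show "\<exists>a\<in>X. \<exists>b\<in>Y. E a b" if "X \<union> Y = V - {u}" "X \<inter> Y = {}" "X \<noteq> {}" "Y \<noteq> {}" for X Y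
            using conn[OF \<open>u \<in> V\<close> that] .
        qed (use ux ne(2) tgt in auto)
        then obtain r w where r: "w \<in> set c - {u}" "r \<noteq> []" "hd r = x" "distinct r"
          "set r \<subseteq> (V - {u}) - (set c - {u})" "successively E (r @ [w])" by blast
        have "u \<in> set c" using ux by simp
        then obtain c1 c2 where c12: "c = c1 @ u # c2" using split_list[of u c] by blast
        have "w \<in> set (c2 @ c1)" using r(1) unfolding c12 by auto
        then obtain p q where pq: "c2 @ c1 = p @ w # q" using split_list[of w "c2 @ c1"] by blast
        have cyc: "cycle_list E (u # p @ w # q)"
          using cycle_list_rotate[of E c1 "u # c2"] c c12 pq by (simp add: P_def)
        have st: "set (u # p @ w # q) = set c"
          using arg_cong[OF pq, of set] unfolding c12 by auto
        have ln: "length (u # p @ w # q) = length c"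
          using arg_cong[OF pq, of length] unfolding c12 by simp
        have rV: "set r \<subseteq> V" using r(5) by blast
        then have "set (u # w # p @ rev q @ r) \<subseteq> V" using st ne(2) by auto
        then have "\<not> theta_paths E u w p (rev q) r" by (rule less.prems(2))
        moreover have "set r \<inter> set (u # p @ w # q) = {}" using r(5) unfolding st by blast
        moreover have "successively E (u # r @ [w])" using r(2,3,6) ux(3) by (simp add: successively_Cons)
        ultimately have "\<exists>c'. cycle_list E c' \<and> set c' \<subseteq> set c \<union> set r \<and> length c < length c'"
          using cycle_list_ear[OF assms(2) cyc r(2,4)] unfolding st ln by blast
        then obtain c' where c': "cycle_list E c'" "set c' \<subseteq> set c \<union> set r" "length c < length c'" by blast
        then have "P c'" using rV ne(2) unfolding P_def by blast
        then show False using mx[of c'] c'(3) by simp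
      qed
      then show ?thesis using c less.prems(3) by (auto simp: P_def cycle_list_def)
    qed
  qed
qed

section \<open>Transfer of the interval argument from positions to vertices\<close>

lemma subseq_nth_Cons:
  assumes "a \<le> i" "i < length vs" "subseq ys (drop (Suc i) vs)"
  shows "subseq (vs ! i # ys) (drop a vs)"
proof -
  have "drop a vs = take (i - a) (drop a vs) @ drop i vs"
    using append_take_drop_id[of "i - a" "drop a vs"] assms(1) by simp
  then have "drop a vs = take (i - a) (drop a vs) @ vs ! i # drop (Suc i) vs"
    using Cons_nth_drop_Suc[OF assms(2)] by simp
  moreover have "subseq (vs ! i # ys) (vs ! i # drop (Suc i) vs)" using assms(3) by simp
  ultimately show ?thesis by (metis list_emb_append2)
qed

lemma noncrossing_ex_dissoc:
  assumes "symp E" "\<And>x. \<not> E x x" "distinct vs" "noncrossing E vs"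
  shows "\<exists>B \<subseteq> set vs. dissoc E B \<and> length vs \<le> 2 * card B"
proof -
  let ?n = "length vs"
  \<comment> \<open>Positions are shifted by one to leave room for the sentinel \<open>0\<close>.\<close>
  define F where "F p q \<longleftrightarrow> p \<in> {1..?n} \<and> q \<in> {1..?n} \<and> E (vs ! (p - 1)) (vs ! (q - 1))" for p q
  have F: "F a c \<Longrightarrow> F b d \<Longrightarrow> False" if "a < b" "b < c" "c < d" for a b c d
  proof -
    assume f: "F a c" "F b d"
    have i: "a - 1 < b - 1" "b - 1 < c - 1" "c - 1 < d - 1" "d - 1 < ?n"
      using f that by (auto simp: F_def)
    have "subseq [vs ! (a - 1), vs ! (b - 1), vs ! (c - 1), vs ! (d - 1)] (drop 0 vs)"
      using i by (intro subseq_nth_Cons) auto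
    then show False using f assms(4) unfolding noncrossing_def F_def by simp
  qed
  have "symp F" using assms(1) by (auto simp: F_def symp_def)
  moreover have "\<not> F p p" for p using assms(2) by (simp add: F_def)
  ultimately obtain A where A: "A \<subseteq> {0<..<Suc ?n}" "dissoc F A" "?n \<le> 2 * card A"
    using noncrossing_dissoc[of F ?n] F by metis
  define f where "f p = vs ! (p - 1)" for p
  have inj: "inj_on f A"
  proof (rule inj_onI)
    fix p q assume "p \<in> A" "q \<in> A" "f p = f q"
    moreover have "0 < p" "p < Suc ?n" "0 < q" "q < Suc ?n" using calculation(1,2) A(1) by auto
    moreover from this have "p - 1 < ?n" "q - 1 < ?n" by linarith+
    ultimately show "p = q" using nth_eq_iff_index_eq[OF assms(3)] by (simp add: f_def)
  qed
  have "dissoc E (f ` A)"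
    unfolding dissoc_def
  proof (intro ballI impI)
    fix x y z assume "x \<in> f ` A" "y \<in> f ` A" "z \<in> f ` A" and e: "E x y" "E x z"
    then obtain p q r where pqr: "p \<in> A" "q \<in> A" "r \<in> A" "x = f p" "y = f q" "z = f r" by blast
    moreover have "A \<subseteq> {1..?n}" using A(1) by auto
    ultimately have "F p q" "F p r" using e unfolding F_def f_def by blast+
    then show "y = z" using A(2) pqr unfolding dissoc_def by blast
  qed
  moreover have "f ` A \<subseteq> set vs"
  proof
    fix x assume "x \<in> f ` A"
    then obtain p where "p \<in> A" "x = vs ! (p - 1)" by (auto simp: f_def)
    moreover from this have "p - 1 < ?n" using A(1) by (auto dest!: subsetD)
    ultimately show "x \<in> set vs" by simp
  qed
  ultimately show ?thesis using A(3) card_image[OF inj] by (intro exI[of _ "f ` A"]) simp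
qed

section \<open>Theta curves in the plane\<close>

lemma outside_subset_Compl: "outside S \<subseteq> - S"
  using outside_no_overlap by blast

lemma in_outside: "x \<notin> S \<Longrightarrow> x \<notin> inside S \<Longrightarrow> x \<in> outside S"
  using inside_Un_outside by blast

lemma arcs_Jordan:
  fixes c1 c2 :: "real \<Rightarrow> complex"
  assumes "arc c1" "pathstart c1 = a" "pathfinish c1 = b"
    and "arc c2" "pathstart c2 = a" "pathfinish c2 = b"
    and "path_image c1 \<inter> path_image c2 = {a, b}"
  shows "inside (path_image c1 \<union> path_image c2) \<noteq> {}"
    and "Topological_Spaces.connected (inside (path_image c1 \<union> path_image c2))"
    and "Topological_Spaces.connected (outside (path_image c1 \<union> path_image c2))"
    and "open (inside (path_image c1 \<union> path_image c2))"
    and "frontier (inside (path_image c1 \<union> path_image c2)) = path_image c1 \<union> path_image c2"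
proof -
  have "simple_path (c1 +++ reversepath c2)"
    using assms by (simp add: simple_path_join_loop_eq arc_reversepath)
  moreover have "pathfinish (c1 +++ reversepath c2) = pathstart (c1 +++ reversepath c2)"
    using assms by simp
  moreover have im: "path_image (c1 +++ reversepath c2) = path_image c1 \<union> path_image c2"
    using assms by (simp add: path_image_join)
  ultimately have J: "inside S \<noteq> {} \<and> open (inside S) \<and> Topological_Spaces.connected (inside S) \<and> Topological_Spaces.connected (outside S) \<and>
      frontier (inside S) = S" if "S = path_image c1 \<union> path_image c2" for S
    using that Jordan_inside_outside[of "c1 +++ reversepath c2"] by simp
  show "inside (path_image c1 \<union> path_image c2) \<noteq> {}"
    "Topological_Spaces.connected (inside (path_image c1 \<union> path_image c2))"
    "Topological_Spaces.connected (outside (path_image c1 \<union> path_image c2))"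
    "open (inside (path_image c1 \<union> path_image c2))"
    "frontier (inside (path_image c1 \<union> path_image c2)) = path_image c1 \<union> path_image c2"
    using J[OF refl] by blast+
qed

definition theta_arcs :: "complex \<Rightarrow> complex \<Rightarrow> (real \<Rightarrow> complex) \<Rightarrow> (real \<Rightarrow> complex) \<Rightarrow> (real \<Rightarrow> complex) \<Rightarrow> bool" where
  "theta_arcs a b c1 c2 c3 \<longleftrightarrow> (\<forall>c \<in> {c1, c2, c3}. arc c \<and> pathstart c = a \<and> pathfinish c = b) \<and>
     path_image c1 \<inter> path_image c2 = {a, b} \<and> path_image c1 \<inter> path_image c3 = {a, b} \<and>
     path_image c2 \<inter> path_image c3 = {a, b}"

lemma theta_arcsD:
  assumes "theta_arcs a b c1 c2 c3"
  shows "arc c1" "pathstart c1 = a" "pathfinish c1 = b"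
    and "arc c2" "pathstart c2 = a" "pathfinish c2 = b"
    and "arc c3" "pathstart c3 = a" "pathfinish c3 = b"
    and "path_image c1 \<inter> path_image c2 = {a, b}" "path_image c1 \<inter> path_image c3 = {a, b}"
    and "path_image c2 \<inter> path_image c3 = {a, b}"
  using assms unfolding theta_arcs_def by blast+

lemma theta_arcs_swap: "theta_arcs a b c1 c2 c3 \<Longrightarrow> theta_arcs a b c2 c1 c3"
  and theta_arcs_swap': "theta_arcs a b c1 c2 c3 \<Longrightarrow> theta_arcs a b c1 c3 c2"
  by (auto simp: theta_arcs_def)

text \<open>Each inside is connected and, by the hypotheses, misses the boundary of the other. If
  they met they would therefore coincide, and so would their boundaries, which leaves no room for
  the interior of \<open>c1\<close>.\<close>

lemma theta_insides_disjoint: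
  assumes th: "theta_arcs a b c1 c2 c3"
    and 1: "path_image c1 \<inter> inside (path_image c2 \<union> path_image c3) = {}"
    and 3: "path_image c3 \<inter> inside (path_image c1 \<union> path_image c2) = {}"
  shows "inside (path_image c2 \<union> path_image c3) \<inter> inside (path_image c1 \<union> path_image c2) = {}"
proof (rule ccontr)
  let ?A = "inside (path_image c2 \<union> path_image c3)" and ?B = "inside (path_image c1 \<union> path_image c2)"
  assume ne: "\<not> ?thesis"
  note t = theta_arcsD[OF th]
  note J12 = arcs_Jordan[OF t(1-6,10)] and J23 = arcs_Jordan[OF t(4-9,12)]
  have "?A \<subseteq> ?B"
  proof (rule ccontr)
    assume "\<not> ?A \<subseteq> ?B"
    then have "?A \<inter> frontier ?B \<noteq> {}"
      using ne J23(2) by (intro connected_Int_frontier) auto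
    moreover have "?A \<inter> (path_image c2 \<union> path_image c3) = {}" by (rule inside_no_overlap)
    ultimately show False unfolding J12(5) using 1 by blast
  qed
  moreover have "?B \<subseteq> ?A"
  proof (rule ccontr)
    assume "\<not> ?B \<subseteq> ?A"
    then have "?B \<inter> frontier ?A \<noteq> {}"
      using ne J12(2) by (intro connected_Int_frontier) auto
    moreover have "?B \<inter> (path_image c1 \<union> path_image c2) = {}" by (rule inside_no_overlap)
    ultimately show False unfolding J23(5) using 3 by blast
  qed
  ultimately have "frontier ?A = frontier ?B" by simp
  then have "path_image c2 \<union> path_image c3 = path_image c1 \<union> path_image c2"
    by (simp add: J12(5) J23(5))
  then have "path_image c1 - {a, b} = {}" using t(10,11) by blast
  then show False using nonempty_simple_path_endless[OF arc_imp_simple_path[OF t(1)]] t(2,3) by simp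
qed

text \<open>If no arc were inside the cycle of the other two, a point inside one of the cycles would be
  outside the other two, and by Janiszewski's theorem outside the whole theta curve.\<close>

lemma theta_arcs_inside:
  assumes th: "theta_arcs a b c1 c2 c3"
  shows "path_image c1 \<inter> inside (path_image c2 \<union> path_image c3) \<noteq> {} \<or>
    path_image c2 \<inter> inside (path_image c1 \<union> path_image c3) \<noteq> {} \<or>
    path_image c3 \<inter> inside (path_image c1 \<union> path_image c2) \<noteq> {}"
proof (rule ccontr)
  assume "\<not> ?thesis"
  then have 1: "path_image c1 \<inter> inside (path_image c2 \<union> path_image c3) = {}"
    and 2: "path_image c2 \<inter> inside (path_image c1 \<union> path_image c3) = {}"
    and 3: "path_image c3 \<inter> inside (path_image c1 \<union> path_image c2) = {}" by auto
  note t = theta_arcsD[OF th]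
  have ends: "{a, b} \<subseteq> path_image c1" using t(10) by blast
  have cpt: "compact (path_image c1)" "compact (path_image c2)" "compact (path_image c3)"
    using t(1,4,7) by (simp_all add: compact_arc_image)
  obtain x where x: "x \<in> inside (path_image c2 \<union> path_image c3)"
    using arcs_Jordan(1)[OF t(4-9,12)] by blast
  have nx: "x \<notin> path_image c1" "x \<notin> path_image c2" "x \<notin> path_image c3"
    using x 1 inside_no_overlap[of "path_image c2 \<union> path_image c3"] by blast+
  have "x \<notin> inside (path_image c1 \<union> path_image c2)"
    using theta_insides_disjoint[OF th 1 3] x by auto
  then have x12: "x \<in> outside (path_image c1 \<union> path_image c2)"
    using nx by (intro in_outside) simp_all
  have "x \<notin> inside (path_image c1 \<union> path_image c3)"
    using theta_insides_disjoint[OF theta_arcs_swap'[OF th]] 1 2 x by (auto simp: Un_commute)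
  then have x13: "x \<in> outside (path_image c1 \<union> path_image c3)"
    using nx by (intro in_outside) simp_all
  let ?T = "(path_image c1 \<union> path_image c2) \<union> (path_image c1 \<union> path_image c3)"
  have "bounded ?T" using cpt by (simp add: compact_imp_bounded)
  then obtain y where y: "y \<in> outside ?T" using outside_bounded_nonempty by blast
  have y12: "y \<in> outside (path_image c1 \<union> path_image c2)" using y outside_mono by blast
  have y13: "y \<in> outside (path_image c1 \<union> path_image c3)" using y outside_mono by blast
  have "connected_component (- ?T) x y"
  proof (rule Janiszewski)
    show "compact (path_image c1 \<union> path_image c2)" "closed (path_image c1 \<union> path_image c3)"
      using cpt by (auto intro: compact_imp_closed)
    \<comment> \<open>The two cycles meet exactly in the arc \<open>c1\<close>; its connectedness is
      the condition under which points separated by neither cycle are not separated by their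
      union.\<close>
    have "(path_image c1 \<union> path_image c2) \<inter> (path_image c1 \<union> path_image c3) = path_image c1"
      using t(12) ends by blast
    then show "Topological_Spaces.connected ((path_image c1 \<union> path_image c2) \<inter> (path_image c1 \<union> path_image c3))"
      using t(1) by (simp add: connected_arc_image)
    show "connected_component (- (path_image c1 \<union> path_image c2)) x y"
      unfolding connected_component_def
      using x12 y12 arcs_Jordan(3)[OF t(1-6,10)] outside_subset_Compl by blast
    show "connected_component (- (path_image c1 \<union> path_image c3)) x y"
      unfolding connected_component_def
      using x13 y13 arcs_Jordan(3)[OF t(1-3,7-9,11)] outside_subset_Compl by blast
  qed
  then have "x \<in> outside ?T"
    using outside_same_component[OF connected_component_sym y] by blast
  then have "x \<in> outside (path_image c2 \<union> path_image c3)"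
    using outside_mono[of "path_image c2 \<union> path_image c3" ?T] by blast
  then show False using x inside_Int_outside[of "path_image c2 \<union> path_image c3"] by blast
qed

text \<open>The outer face condition acts through this fact. The inside of \<open>S\<close> is open,
  so around \<open>p\<close> it would contain points of \<open>outside D\<close>, which lies in
  \<open>outside S\<close>.\<close>

lemma frontier_outside_not_inside:
  fixes S D :: "complex set"
  assumes "closed S" "S \<subseteq> D" "p \<in> frontier (outside D)"
  shows "p \<notin> inside S"
proof
  assume "p \<in> inside S"
  moreover have "p \<in> closure (outside D)" using assms(3) by (simp add: frontier_def)
  ultimately have "inside S \<inter> outside D \<noteq> {}"
    using open_inside[OF assms(1)] closure_iff_nhds_not_empty[of p "outside D"] by (metis Int_commute order_refl)
  then show False using outside_mono[OF assms(2)] inside_Int_outside[of S] by blast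
qed

text \<open>Without its ends \<open>c3\<close> is connected and misses \<open>c1\<close> and
  \<open>c2\<close>, which form the frontier of the inside. So it cannot be partly inside.\<close>

lemma theta_arc_subset_inside:
  assumes th: "theta_arcs a b c1 c2 c3"
    and meet: "path_image c3 \<inter> inside (path_image c1 \<union> path_image c2) \<noteq> {}"
  shows "path_image c3 - {a, b} \<subseteq> inside (path_image c1 \<union> path_image c2)"
proof (rule ccontr)
  let ?M = "path_image c3 - {a, b}" and ?I = "inside (path_image c1 \<union> path_image c2)"
  note t = theta_arcsD[OF th]
  assume "\<not> ?M \<subseteq> ?I"
  moreover have "Topological_Spaces.connected ?M"
    using connected_simple_path_endless[OF arc_imp_simple_path[OF t(7)]] t(8,9) by simp
  moreover have "{a, b} \<inter> ?I = {}"
    using t(10) inside_no_overlap[of "path_image c1 \<union> path_image c2"] by blast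
  then have "?M \<inter> ?I \<noteq> {}" using meet by blast
  ultimately have "?M \<inter> frontier ?I \<noteq> {}" by (intro connected_Int_frontier) auto
  then show False unfolding arcs_Jordan(5)[OF t(1-6,10)] using t(11,12) by blast
qed

text \<open>Some arc runs inside the cycle of the other two. The outer points \<open>p\<close> and
  \<open>q\<close> show that it is neither \<open>c1\<close> nor \<open>c2\<close>.\<close>

lemma theta_arcs_outer_inside:
  assumes th: "theta_arcs a b c1 c2 c3"
    and sub: "path_image c1 \<union> path_image c2 \<union> path_image c3 \<subseteq> D"
    and p: "p \<in> path_image c1 - {a, b}" "p \<in> frontier (outside D)"
    and q: "q \<in> path_image c2 - {a, b}" "q \<in> frontier (outside D)"
  shows "path_image c3 - {a, b} \<subseteq> inside (path_image c1 \<union> path_image c2)"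
proof -
  have cl: "closed (path_image c1)" "closed (path_image c2)" "closed (path_image c3)"
    using theta_arcsD(1,4,7)[OF th] by (simp_all add: closed_arc_image)
  have "p \<notin> inside (path_image c2 \<union> path_image c3)" "q \<notin> inside (path_image c1 \<union> path_image c3)"
    by (rule frontier_outside_not_inside[OF _ _ p(2)] frontier_outside_not_inside[OF _ _ q(2)];
        use sub cl in auto)+
  then have "\<not> path_image c1 - {a, b} \<subseteq> inside (path_image c2 \<union> path_image c3)"
    "\<not> path_image c2 - {a, b} \<subseteq> inside (path_image c1 \<union> path_image c3)"
    using p(1) q(1) by auto
  moreover have "theta_arcs a b c2 c3 c1" "theta_arcs a b c1 c3 c2"
    using th theta_arcs_swap theta_arcs_swap' by metis+
  note sub = theta_arc_subset_inside[OF this(1)] theta_arc_subset_inside[OF this(2)]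
    theta_arc_subset_inside[OF th]
  from theta_arcs_inside[OF th] show ?thesis
    using calculation sub by (elim disjE) simp_all
qed

lemma arc_end_in_closure:
  assumes "arc c"
  shows "{pathstart c, pathfinish c} \<subseteq> closure (path_image c - {pathstart c, pathfinish c})"
proof -
  have "c ` closure {0<..<1} \<subseteq> closure (c ` {0<..<1})"
    using assms by (intro image_closure_subset closed_closure closure_subset)
      (auto simp: arc_def path_def closure_greaterThanLessThan)
  moreover have "{0, 1} \<subseteq> closure {0<..<1::real}" by simp
  ultimately have "c ` {0, 1} \<subseteq> closure (c ` {0<..<1})" by blast
  then show ?thesis
    unfolding simple_path_endless[OF arc_imp_simple_path[OF assms]]
    by (simp add: pathstart_def pathfinish_def)
qed

text \<open>The arc \<open>c3\<close> cuts the inside of the cycle into two regions, and the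
  interior of \<open>c4\<close>, being connected and disjoint from \<open>c3\<close>, stays in one
  of them. But \<open>q\<close> is not in the closure of the region along \<open>c1\<close>, and
  \<open>p\<close> is not in the closure of the region along \<open>c2\<close>.\<close>

lemma theta_no_crossing_arc:
  assumes th: "theta_arcs a b c1 c2 c3"
    and c3: "path_image c3 \<inter> inside (path_image c1 \<union> path_image c2) \<noteq> {}"
    and c4: "arc c4" "pathstart c4 = p" "pathfinish c4 = q" "path_image c4 \<inter> path_image c3 = {}"
    and p: "p \<in> path_image c1 - {a, b}" and q: "q \<in> path_image c2 - {a, b}"
    and M: "path_image c4 - {p, q} \<subseteq> inside (path_image c1 \<union> path_image c2)"
  shows False
proof -
  let ?I1 = "inside (path_image c1 \<union> path_image c3)" and ?I2 = "inside (path_image c2 \<union> path_image c3)"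
  let ?M = "path_image c4 - {p, q}"
  note t = theta_arcsD[OF th]
  have "a \<noteq> b" using arc_distinct_ends[OF t(1)] t(2,3) by simp
  have split: "?I1 \<inter> ?I2 = {}" "?I1 \<union> ?I2 \<union> (path_image c3 - {a, b}) = inside (path_image c1 \<union> path_image c2)"
    by (rule split_inside_simple_closed_curve[of c1 a b c2 c3];
        use t c3 \<open>a \<noteq> b\<close> in \<open>simp add: arc_imp_simple_path\<close>)+
  note J1 = arcs_Jordan(4,5)[OF t(1-3,7-9,11)] and J2 = arcs_Jordan(4,5)[OF t(4-9,12)]
  have "Topological_Spaces.connected ?M"
    using connected_simple_path_endless[OF arc_imp_simple_path[OF c4(1)]] c4(2,3) by simp
  moreover have "?M \<subseteq> ?I1 \<union> ?I2" using M split(2) c4(4) by blast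
  ultimately have "?M \<subseteq> ?I1 \<or> ?M \<subseteq> ?I2"
    using connectedD[of ?M ?I1 ?I2] J1(1) J2(1) split(1) by blast
  moreover have pq: "{p, q} \<subseteq> closure ?M" using arc_end_in_closure[OF c4(1)] c4 by simp
  ultimately have "q \<in> closure ?I1 \<or> p \<in> closure ?I2"
    by (meson closure_mono insert_subset subsetD)
  moreover have "q \<notin> path_image c1 \<union> path_image c3" "p \<notin> path_image c2 \<union> path_image c3"
    using p q t(10-12) by blast+
  ultimately have "q \<in> ?I1 \<or> p \<in> ?I2"
    unfolding closure_Un_frontier J1(2) J2(2) by blast
  then show False
    using split(2) p q inside_no_overlap[of "path_image c1 \<union> path_image c2"] by blast
qed

section \<open>Outerplanar drawings\<close>

lemma successively_infix: "successively P (xs @ ys @ zs) \<Longrightarrow> successively P ys"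
  by (simp add: successively_append_iff)

lemma successively_overlap:
  "successively P (xs @ [x]) \<Longrightarrow> successively P (x # ys) \<Longrightarrow> successively P (xs @ x # ys)"
  by (auto simp: successively_append_iff)

fun path_edges :: "'a list \<Rightarrow> 'a set set" where
  "path_edges (x # y # zs) = insert {x, y} (path_edges (y # zs))"
| "path_edges _ = {}"

lemma path_edges_subset: "e \<in> path_edges xs \<Longrightarrow> e \<subseteq> set xs"
  by (induction xs rule: path_edges.induct) auto

lemma path_edges_append: "path_edges (xs @ x # ys) = path_edges (xs @ [x]) \<union> path_edges (x # ys)"
proof (induction xs)
  case Nil
  then show ?case by simp
next
  case (Cons a xs)
  then show ?case by (cases xs) auto
qed

lemma path_edges_rev: "path_edges (rev xs) = path_edges xs"
proof (induction xs rule: path_edges.induct)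
  case (1 x y zs)
  then show ?case
    using path_edges_append[of "rev zs" y "[x]"] by (auto simp: insert_commute)
qed auto

lemma ends_notin_path_edges:
  assumes "distinct (u # w # p)" "p \<noteq> []"
  shows "{u, w} \<notin> path_edges (u # p @ [w])"
proof -
  obtain y p' where p: "p = y # p'" using assms(2) by (cases p) auto
  have "{u, w} \<noteq> {u, y}" using assms(1) p by (auto simp: doubleton_eq_iff)
  moreover have "u \<notin> set (p @ [w])" using assms(1) by auto
  ultimately show ?thesis using path_edges_subset[of "{u, w}" "p @ [w]"] p by auto
qed

lemma path_edges_uedges:
  assumes "successively (\<lambda>x y. (x, y) \<in> parcs G) xs"
  shows "path_edges xs \<subseteq> uedges G"
  using assms by (induction xs rule: path_edges.induct) (auto simp: uedges_def)

section \<open>Paths, thetas and chords in a fixed outerplanar drawing\<close>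

locale outer_drawing =
  fixes G :: "'a pair_pre_digraph" and pt :: "'a \<Rightarrow> complex" and crv :: "'a set \<Rightarrow> real \<Rightarrow> complex"
  assumes graph: "pair_graph G" and drawing: "plane_drawing G pt crv"
    and outer: "pt ` pverts G \<subseteq> frontier (outside (drawing_set G pt crv))"
begin

abbreviation adj :: "'a \<Rightarrow> 'a \<Rightarrow> bool" where
  "adj x y \<equiv> (x, y) \<in> parcs G"

lemma adjD: "adj x y \<Longrightarrow> x \<in> pverts G" "adj x y \<Longrightarrow> y \<in> pverts G" "adj x y \<Longrightarrow> x \<noteq> y"
  "adj x y \<Longrightarrow> adj y x"
proof -
  interpret pair_graph G by (rule graph)
  show "adj x y \<Longrightarrow> x \<in> pverts G" "adj x y \<Longrightarrow> y \<in> pverts G" using in_arcsD1 in_arcsD2 by auto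
  show "adj x y \<Longrightarrow> x \<noteq> y" using pair_no_loops by fastforce
  show "adj x y \<Longrightarrow> adj y x" using pair_sym_arcs by (auto simp: symmetric_def symD)
qed

lemma adj_symp: "symp adj"
  using adjD(4) by (auto simp: symp_def)

lemma uedges_subset: "e \<in> uedges G \<Longrightarrow> e \<subseteq> pverts G"
  using adjD by (auto simp: uedges_def)

lemma inj_pt: "inj_on pt (pverts G)"
  using drawing by (simp add: plane_drawing_def)

lemma edge_curve:
  assumes "e \<in> uedges G"
  shows "arc (crv e)" "{pathstart (crv e), pathfinish (crv e)} = pt ` e"
  using drawing assms by (auto simp: plane_drawing_def)

lemma edge_curve_vertex:
  assumes "e \<in> uedges G"
  shows "path_image (crv e) \<inter> pt ` pverts G = pt ` e"
proof -
  have "pt ` e \<subseteq> path_image (crv e)"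
    using edge_curve(2)[OF assms, symmetric] by auto
  moreover have "(path_image (crv e) - pt ` e) \<inter> pt ` pverts G = {}"
    using drawing assms by (auto simp: plane_drawing_def)
  ultimately show ?thesis using uedges_subset[OF assms] by blast
qed

lemma edge_curves_meet:
  assumes "e \<in> uedges G" "f \<in> uedges G" "e \<noteq> f"
  shows "path_image (crv e) \<inter> path_image (crv f) \<subseteq> pt ` (e \<inter> f)"
proof
  fix z assume z: "z \<in> path_image (crv e) \<inter> path_image (crv f)"
  have "(path_image (crv e) - pt ` e) \<inter> path_image (crv f) = {}"
    "(path_image (crv f) - pt ` f) \<inter> path_image (crv e) = {}"
    using drawing assms assms(3)[symmetric] unfolding plane_drawing_def by simp_all
  then have "z \<in> pt ` e \<inter> pt ` f" using z by blast
  then show "z \<in> pt ` (e \<inter> f)"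
    using inj_on_image_Int[OF inj_pt uedges_subset[OF assms(1)] uedges_subset[OF assms(2)]] by simp
qed

definition curves :: "'a set set \<Rightarrow> complex set" where
  "curves F = (\<Union>e\<in>F. path_image (crv e))"

lemma curves_Un: "curves (A \<union> B) = curves A \<union> curves B"
  by (auto simp: curves_def)

lemma curves_subset_drawing: "F \<subseteq> uedges G \<Longrightarrow> curves F \<subseteq> drawing_set G pt crv"
  by (auto simp: curves_def drawing_set_def)

lemma curves_meet:
  assumes "A \<subseteq> uedges G" "B \<subseteq> uedges G" "A \<inter> B = {}"
  shows "curves A \<inter> curves B \<subseteq> pt ` (\<Union>A \<inter> \<Union>B)"
proof
  fix z assume "z \<in> curves A \<inter> curves B"
  then obtain e f where ef: "e \<in> A" "f \<in> B" "z \<in> path_image (crv e) \<inter> path_image (crv f)"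
    by (auto simp: curves_def)
  then have "z \<in> pt ` (e \<inter> f)" using edge_curves_meet[of e f] assms by blast
  then show "z \<in> pt ` (\<Union>A \<inter> \<Union>B)" using ef by blast
qed

lemma pt_in_curves:
  assumes "F \<subseteq> uedges G" "v \<in> \<Union>F"
  shows "pt v \<in> curves F"
proof -
  obtain e where e: "e \<in> F" "v \<in> e" using assms(2) by blast
  then have "pt v \<in> path_image (crv e)" using edge_curve_vertex[of e] assms(1) by blast
  then show ?thesis using e(1) unfolding curves_def by blast
qed

lemma Union_path_edges: "2 \<le> length xs \<Longrightarrow> \<Union>(path_edges xs) = set xs"
proof (induction xs rule: path_edges.induct)
  case (1 x y zs)
  then show ?case by (cases zs) auto
qed auto

lemma oriented_edge_arc:
  assumes "adj x y"
  obtains g where "arc g" "pathstart g = pt x" "pathfinish g = pt y" "path_image g = path_image (crv {x, y})"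
proof -
  have e: "{x, y} \<in> uedges G" using assms by (auto simp: uedges_def)
  have "{pathstart (crv {x, y}), pathfinish (crv {x, y})} = {pt x, pt y}"
    using edge_curve(2)[OF e] by simp
  then consider "pathstart (crv {x, y}) = pt x" "pathfinish (crv {x, y}) = pt y"
    | "pathstart (crv {x, y}) = pt y" "pathfinish (crv {x, y}) = pt x"
    unfolding doubleton_eq_iff by blast
  then show thesis
  proof cases
    case 1
    then show thesis using that edge_curve(1)[OF e] by blast
  next
    case 2
    then show thesis
      using that[of "reversepath (crv {x, y})"] edge_curve(1)[OF e] by (simp add: arc_reversepath)
  qed
qed

lemma ex_path_arc:
  assumes "successively adj xs" "distinct xs" "2 \<le> length xs"
  shows "\<exists>g. arc g \<and> pathstart g = pt (hd xs) \<and> pathfinish g = pt (last xs) \<and>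
    path_image g = curves (path_edges xs)"
  using assms
proof (induction xs rule: path_edges.induct)
  case (1 x y zs)
  have xy: "adj x y" using 1 by simp
  have "curves {{x, y}} = path_image (crv {x, y})" by (simp add: curves_def)
  then obtain h where h: "arc h" "pathstart h = pt x" "pathfinish h = pt y" "path_image h = curves {{x, y}}"
    using oriented_edge_arc[OF xy] by metis
  show ?case
  proof (cases zs)
    case Nil
    then show ?thesis using h by (intro exI[of _ h]) simp
  next
    case (Cons z zs')
    then obtain g where g: "arc g" "pathstart g = pt y" "pathfinish g = pt (last (y # zs))"
      "path_image g = curves (path_edges (y # zs))" using 1 by auto
    have E: "{{x, y}} \<subseteq> uedges G" "path_edges (y # zs) \<subseteq> uedges G"
      using path_edges_uedges[of G "x # y # zs"] 1(2) by auto
    have d: "{{x, y}} \<inter> path_edges (y # zs) = {}"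
      using path_edges_subset[of "{x, y}" "y # zs"] 1(3) by auto
    have "\<Union>{{x, y}} \<inter> \<Union>(path_edges (y # zs)) \<subseteq> {y}"
      using path_edges_subset[of _ "y # zs"] 1(3) by fastforce
    then have "pt ` (\<Union>{{x, y}} \<inter> \<Union>(path_edges (y # zs))) \<subseteq> {pt y}" by blast
    then have "path_image h \<inter> path_image g \<subseteq> {pathstart g}"
      using curves_meet[OF E d] unfolding h(4) g(2,4) by (rule order_trans[rotated])
    then have "arc (h +++ g)" using arc_join[OF h(1) g(1)] h(3) g(2) by simp
    moreover have "path_image (h +++ g) = curves (path_edges (x # y # zs))"
      using path_image_join[of h g] h(3,4) g(2,4) by (simp add: curves_def)
    ultimately show ?thesis using h g by (intro exI[of _ "h +++ g"]) simp
  qed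
qed auto

text \<open>The list \<open>q\<close> may be empty, so that one of the paths can be a chord. A
  common edge could only join \<open>u\<close> and \<open>w\<close>, and the path through the
  nonempty \<open>p\<close> does not contain that edge; edge-disjoint paths meet only in images of
  common vertices.\<close>

lemma paths_meet:
  assumes "distinct (u # w # p @ q)" "p \<noteq> []"
    and "successively adj (u # p @ [w])" "successively adj (u # q @ [w])"
  shows "curves (path_edges (u # p @ [w])) \<inter> curves (path_edges (u # q @ [w])) = {pt u, pt w}"
proof -
  let ?P = "path_edges (u # p @ [w])" and ?Q = "path_edges (u # q @ [w])"
  have E: "?P \<subseteq> uedges G" "?Q \<subseteq> uedges G" using assms(3,4) path_edges_uedges by blast+
  have U: "\<Union>?P = set (u # p @ [w])" "\<Union>?Q = set (u # q @ [w])"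
    by (rule Union_path_edges; simp)+
  have I: "\<Union>?P \<inter> \<Union>?Q = {u, w}" unfolding U using assms(1) by auto
  have "?P \<inter> ?Q = {}"
  proof (rule ccontr)
    assume "?P \<inter> ?Q \<noteq> {}"
    then obtain e where e: "e \<in> ?P" "e \<in> ?Q" by blast
    then have "e \<subseteq> {u, w}" using I by blast
    moreover obtain x y where "e = {x, y}" "x \<noteq> y" using e(1) E adjD(3) by (auto simp: uedges_def)
    ultimately have "e = {u, w}" by auto
    then show False using ends_notin_path_edges[of u w p] assms(1,2) e(1) by auto
  qed
  then have "curves ?P \<inter> curves ?Q \<subseteq> {pt u, pt w}"
    using curves_meet[OF E] I by auto
  moreover have "{pt u, pt w} \<subseteq> curves ?P \<inter> curves ?Q"
    using pt_in_curves[OF E(1)] pt_in_curves[OF E(2)] U by auto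
  ultimately show ?thesis by blast
qed

lemma finite_pverts: "finite (pverts G)"
  using graph by (simp add: pair_graph_def pair_digraph_def pair_fin_digraph.pair_finite_verts)

lemma path_curves_subset_drawing:
  "successively adj xs \<Longrightarrow> curves (path_edges xs) \<subseteq> drawing_set G pt crv"
  by (intro curves_subset_drawing path_edges_uedges)

lemma ex_inner_path_arc:
  assumes "successively adj (u # p @ [w])" "distinct (u # w # p)"
  shows "\<exists>c. arc c \<and> pathstart c = pt u \<and> pathfinish c = pt w \<and> path_image c = curves (path_edges (u # p @ [w]))"
  using ex_path_arc[OF assms(1)] assms(2) by simp

lemma ex_theta_arcs:
  assumes d: "distinct (u # w # p @ q @ r)" and ne: "p \<noteq> []" "q \<noteq> []"
    and s: "successively adj (u # p @ [w])" "successively adj (u # q @ [w])" "successively adj (u # r @ [w])"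
  shows "\<exists>c1 c2 c3. theta_arcs (pt u) (pt w) c1 c2 c3 \<and> path_image c1 = curves (path_edges (u # p @ [w])) \<and>
     path_image c2 = curves (path_edges (u # q @ [w])) \<and> path_image c3 = curves (path_edges (u # r @ [w]))"
proof -
  have ds: "distinct (u # w # p @ q)" "distinct (u # w # p @ r)" "distinct (u # w # q @ r)"
    using d by auto
  have dd: "distinct (u # w # p)" "distinct (u # w # q)" "distinct (u # w # r)" using d by auto
  obtain c1 where c1: "arc c1" "pathstart c1 = pt u" "pathfinish c1 = pt w" "path_image c1 = curves (path_edges (u # p @ [w]))"
    using ex_inner_path_arc[OF s(1) dd(1)] by blast
  obtain c2 where c2: "arc c2" "pathstart c2 = pt u" "pathfinish c2 = pt w" "path_image c2 = curves (path_edges (u # q @ [w]))"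
    using ex_inner_path_arc[OF s(2) dd(2)] by blast
  obtain c3 where c3: "arc c3" "pathstart c3 = pt u" "pathfinish c3 = pt w" "path_image c3 = curves (path_edges (u # r @ [w]))"
    using ex_inner_path_arc[OF s(3) dd(3)] by blast
  have "theta_arcs (pt u) (pt w) c1 c2 c3"
    unfolding theta_arcs_def c1(4) c2(4) c3(4)
    using paths_meet[OF ds(1) ne(1) s(1,2)] paths_meet[OF ds(2) ne(1) s(1,3)] paths_meet[OF ds(3) ne(2) s(2,3)]
      c1 c2 c3 by simp
  then show ?thesis using c1(4) c2(4) c3(4) by blast
qed

lemma inner_vertex:
  assumes "successively adj (u # p @ [w])" "distinct (u # w # p)" "v \<in> set p"
  shows "pt v \<in> curves (path_edges (u # p @ [w])) - {pt u, pt w}"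
    and "pt v \<in> frontier (outside (drawing_set G pt crv))"
proof -
  have E: "path_edges (u # p @ [w]) \<subseteq> uedges G" using assms(1) path_edges_uedges by blast
  have U: "\<Union>(path_edges (u # p @ [w])) = set (u # p @ [w])" by (rule Union_path_edges) simp
  have V: "set (u # p @ [w]) \<subseteq> pverts G" using uedges_subset E unfolding U[symmetric] by blast
  have "pt v \<in> curves (path_edges (u # p @ [w]))"
    by (rule pt_in_curves[OF E]) (use U assms(3) in auto)
  moreover have "pt v \<noteq> pt u" "pt v \<noteq> pt w"
    using assms(2,3) V inj_onD[OF inj_pt, of v u] inj_onD[OF inj_pt, of v w] by auto
  ultimately show "pt v \<in> curves (path_edges (u # p @ [w])) - {pt u, pt w}" by simp
  show "pt v \<in> frontier (outside (drawing_set G pt crv))" using outer V assms(3) by auto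
qed

text \<open>Inner vertices of \<open>p\<close> and \<open>q\<close> supply the outer points needed
  on the first two arcs. Nothing is asked of \<open>r\<close>: a nonempty \<open>r\<close> serves to
  exclude thetas, an empty one to locate chords.\<close>

lemma third_path_inside:
  assumes d: "distinct (u # w # p @ q @ r)" and ne: "p \<noteq> []" "q \<noteq> []"
    and s: "successively adj (u # p @ [w])" "successively adj (u # q @ [w])" "successively adj (u # r @ [w])"
  shows "curves (path_edges (u # r @ [w])) - {pt u, pt w} \<subseteq>
    inside (curves (path_edges (u # p @ [w])) \<union> curves (path_edges (u # q @ [w])))"
proof -
  obtain c1 c2 c3 where th: "theta_arcs (pt u) (pt w) c1 c2 c3"
    and im: "path_image c1 = curves (path_edges (u # p @ [w]))"
     "path_image c2 = curves (path_edges (u # q @ [w]))" "path_image c3 = curves (path_edges (u # r @ [w]))"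
    using ex_theta_arcs[OF assms] by blast
  have dd: "distinct (u # w # p)" "distinct (u # w # q)" using d by auto
  have "curves (path_edges (u # p @ [w])) \<union> curves (path_edges (u # q @ [w])) \<union>
      curves (path_edges (u # r @ [w])) \<subseteq> drawing_set G pt crv"
    using s by (intro Un_least path_curves_subset_drawing)
  note sub = this
  show ?thesis
    by (rule theta_arcs_outer_inside[OF th, unfolded im, OF sub
        inner_vertex[OF s(1) dd(1) hd_in_set[OF ne(1)]] inner_vertex[OF s(2) dd(2) hd_in_set[OF ne(2)]]])
qed

lemma closed_curves_Un:
  assumes "successively adj (u # p @ [w])" "successively adj (u # q @ [w])" "distinct (u # w # p)" "distinct (u # w # q)"
  shows "closed (curves (path_edges (u # p @ [w])) \<union> curves (path_edges (u # q @ [w])))"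
proof -
  obtain c1 c2 where "arc c1" "path_image c1 = curves (path_edges (u # p @ [w]))"
    "arc c2" "path_image c2 = curves (path_edges (u # q @ [w]))"
    using ex_inner_path_arc[OF assms(1,3)] ex_inner_path_arc[OF assms(2,4)] by blast
  then show ?thesis by (metis closed_Un closed_arc_image)
qed

text \<open>An inner vertex of the third path would lie inside the cycle of the other two, although
  every vertex is on the outer face.\<close>

lemma no_theta_paths: "\<not> theta_paths adj u w p q r"
proof
  assume "theta_paths adj u w p q r"
  then have d: "distinct (u # w # p @ q @ r)" and ne: "p \<noteq> []" "q \<noteq> []" "r \<noteq> []"
    and s: "successively adj (u # p @ [w])" "successively adj (u # q @ [w])" "successively adj (u # r @ [w])"
    unfolding theta_paths_def by simp_all
  have dd: "distinct (u # w # p)" "distinct (u # w # q)" "distinct (u # w # r)" using d by auto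
  have "hd r \<in> set r" using ne by simp
  note v = inner_vertex[OF s(3) dd(3) this]
  have "pt (hd r) \<in> inside (curves (path_edges (u # p @ [w])) \<union> curves (path_edges (u # q @ [w])))"
    using third_path_inside[OF d ne(1,2) s] v(1) by blast
  moreover have "curves (path_edges (u # p @ [w])) \<union> curves (path_edges (u # q @ [w])) \<subseteq> drawing_set G pt crv"
    using s by (intro Un_least path_curves_subset_drawing)
  ultimately show False
    using frontier_outside_not_inside[OF closed_curves_Un[OF s(1,2) dd(1,2)] _ v(2)] by blast
qed

text \<open>The cycle is read in two ways, as two paths between \<open>a\<close> and
  \<open>c\<close> and as two paths between \<open>b\<close> and \<open>d\<close>. Both readings
  place the respective chord inside the same closed curve, where the chord from \<open>b\<close> to
  \<open>d\<close> cannot avoid the chord from \<open>a\<close> to \<open>c\<close>.\<close>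

lemma no_crossing_chords:
  assumes cyc: "cycle_list adj (a # A @ b # B @ c # C @ d # D)" and ac: "adj a c" and bd: "adj b d"
  shows False
proof -
  let ?p = "A @ b # B" and ?q = "rev D @ d # rev C" and ?p' = "B @ c # C" and ?q' = "rev A @ a # rev D"
  have "successively adj ((a # A @ b # B @ c # C @ d # D) @ [a])"
    using cyc unfolding cycle_list_def successively_append_iff[of adj _ "[a]"] by simp
  then have s: "successively adj (a # A @ b # B @ c # C @ d # D @ [a])" by simp
  have "distinct (a # A @ b # B @ c # C @ d # D)" using cyc by (simp add: cycle_list_def)
  then have dist: "distinct (a # c # ?p @ ?q @ [])" "distinct (b # d # ?p' @ ?q' @ [])" by auto
  have s1: "successively adj (a # ?p @ [c])"
    using successively_infix[of adj "[]" "a # ?p @ [c]" "C @ d # D @ [a]"] s by simp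
  have s2: "successively adj (c # C @ d # D @ [a])"
    using successively_infix[of adj "a # A @ b # B" "c # C @ d # D @ [a]" "[]"] s by simp
  have s3: "successively adj (b # ?p' @ [d])"
    using successively_infix[of adj "a # A" "b # ?p' @ [d]" "D @ [a]"] s by simp
  have s4: "successively adj (d # D @ [a])"
    using successively_infix[of adj "a # A @ b # B @ c # C" "d # D @ [a]" "[]"] s by simp
  have s5: "successively adj (a # A @ [b])"
    using successively_infix[of adj "[]" "a # A @ [b]" "B @ c # C @ d # D @ [a]"] s by simp
  have s6: "successively adj (a # ?q @ [c])" using successively_rev_symp[OF adj_symp s2] by simp
  have s7: "successively adj (b # ?q' @ [d])"
    using successively_overlap[of adj "b # rev A" a "rev D @ [d]"]
      successively_rev_symp[OF adj_symp s4] successively_rev_symp[OF adj_symp s5] by simp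
  have s8: "successively adj (a # [] @ [c])" "successively adj (b # [] @ [d])" using ac bd by auto
  let ?P = "path_edges (a # ?p @ [c])" and ?Q = "path_edges (a # ?q @ [c])"
  let ?P' = "path_edges (b # ?p' @ [d])" and ?Q' = "path_edges (b # ?q' @ [d])"
  \<comment> \<open>Both decompositions cover the same edges of the cycle, so the two insides are
    those of one curve.\<close>
  have eq: "?P \<union> ?Q = ?P' \<union> ?Q'"
  proof -
    have "?Q = path_edges (c # C @ d # D @ [a])"
      using path_edges_rev[of "c # C @ d # D @ [a]"] by simp
    moreover have "path_edges (c # C @ d # D @ [a]) = path_edges (c # C @ [d]) \<union> path_edges (d # D @ [a])"
      using path_edges_append[of "c # C" d "D @ [a]"] by simp
    moreover have "?P = path_edges (a # A @ [b]) \<union> path_edges (b # B @ [c])"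
      using path_edges_append[of "a # A" b "B @ [c]"] by simp
    moreover have "?P' = path_edges (b # B @ [c]) \<union> path_edges (c # C @ [d])"
      using path_edges_append[of "b # B" c "C @ [d]"] by simp
    moreover have "?Q' = path_edges (a # A @ [b]) \<union> path_edges (d # D @ [a])"
      using path_edges_append[of "b # rev A" a "rev D @ [d]"] path_edges_rev[of "a # A @ [b]"]
        path_edges_rev[of "d # D @ [a]"] by simp
    ultimately show ?thesis by blast
  qed
  have E: "?P \<subseteq> uedges G" "?Q \<subseteq> uedges G" "{{a, c}} \<subseteq> uedges G" "{{b, d}} \<subseteq> uedges G"
    using path_edges_uedges[OF s1] path_edges_uedges[OF s6] path_edges_uedges[OF s8(1)] path_edges_uedges[OF s8(2)]
    by auto
  have c3: "curves {{a, c}} - {pt a, pt c} \<subseteq> inside (curves ?P \<union> curves ?Q)"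
    using third_path_inside[OF dist(1) _ _ s1 s6 s8(1)] by simp
  have c4: "curves {{b, d}} - {pt b, pt d} \<subseteq> inside (curves ?P' \<union> curves ?Q')"
    using third_path_inside[OF dist(2) _ _ s3 s7 s8(2)] by simp
  obtain g1 g2 g3 where th: "theta_arcs (pt a) (pt c) g1 g2 g3"
    and im: "path_image g1 = curves ?P" "path_image g2 = curves ?Q" "path_image g3 = curves {{a, c}}"
    using ex_theta_arcs[OF dist(1) _ _ s1 s6 s8(1)] by auto
  obtain g4 where g4: "arc g4" "pathstart g4 = pt b" "pathfinish g4 = pt d" "path_image g4 = curves {{b, d}}"
    using ex_path_arc[OF s8(2)] dist(2) by auto
  have "curves {{b, d}} \<inter> curves {{a, c}} \<subseteq> pt ` (\<Union>{{b, d}} \<inter> \<Union>{{a, c}})"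
    using dist(1) by (intro curves_meet E) (auto simp: doubleton_eq_iff)
  moreover have "\<Union>{{b, d}} \<inter> \<Union>{{a, c}} = {}" using dist(1) by auto
  ultimately have disj: "path_image g4 \<inter> path_image g3 = {}" unfolding im g4(4) by simp
  \<comment> \<open>An inclusion in the inside would be vacuous for an arc without interior points;
    this yields an actual point of the chord inside the cycle.\<close>
  have "path_image g3 - {pt a, pt c} \<noteq> {}"
    using nonempty_simple_path_endless[OF arc_imp_simple_path[OF theta_arcsD(7)[OF th]]] theta_arcsD(8,9)[OF th] by simp
  then have ne: "path_image g3 \<inter> inside (path_image g1 \<union> path_image g2) \<noteq> {}" using c3 unfolding im by blast
  show False
  proof (rule theta_no_crossing_arc[OF th ne g4(1,2,3) disj])
    show "pt b \<in> path_image g1 - {pt a, pt c}"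
      using inner_vertex(1)[OF s1, of b] dist(1) unfolding im by auto
    show "pt d \<in> path_image g2 - {pt a, pt c}"
      using inner_vertex(1)[OF s6, of d] dist(1) unfolding im by auto
    show "path_image g4 - {pt b, pt d} \<subseteq> inside (path_image g1 \<union> path_image g2)"
      using c4 unfolding im g4(4) curves_Un[symmetric] eq .
  qed
qed

lemma cycle_noncrossing:
  assumes "cycle_list adj vs"
  shows "noncrossing adj vs"
  unfolding noncrossing_def
proof (intro allI impI notI)
  fix a b c d assume "subseq [a, b, c, d] vs" and e: "adj a c \<and> adj b d"
  then obtain Z A B C D where "vs = Z @ a # A @ b # B @ c # C @ d # D"
    by (auto dest!: list_emb_ConsD)
  then have "cycle_list adj (a # A @ b # B @ c # C @ d # (D @ Z))"
    using cycle_list_rotate[of adj Z "a # A @ b # B @ c # C @ d # D"] assms by simp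
  then show False using no_crossing_chords e by blast
qed

lemma ex_dissociation_set: "\<exists>B \<subseteq> pverts G. dissoc adj B \<and> card (pverts G) \<le> 2 * card B"
proof -
  obtain vs where vs: "distinct vs" "set vs = pverts G" "noncrossing adj vs"
    using ex_noncrossing_order[OF finite_pverts adj_symp no_theta_paths cycle_noncrossing] by blast
  have "\<not> adj x x" for x using adjD(3) by blast
  then show ?thesis
    using noncrossing_ex_dissoc[OF adj_symp _ vs(1,3)] vs(2) distinct_card[OF vs(1)] by auto
qed

end

text \<open>A path on three vertices that avoids the complement lies in \<open>B\<close>, and its
  middle vertex then has two distinct neighbours there.\<close>

lemma path_vertex_cover_3_Diff:
  assumes "dissoc (\<lambda>x y. (x, y) \<in> parcs G) B" "\<And>x y. (x, y) \<in> parcs G \<Longrightarrow> (y, x) \<in> parcs G"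
  shows "path_vertex_cover 3 G (pverts G - B)"
  unfolding path_vertex_cover_def
proof (intro conjI allI impI notI)
  fix xs assume xs: "vpath xs (with_proj G) \<and> length xs = 3" and no: "set xs \<inter> (pverts G - B) = {}"
  then obtain x y z where xyz: "xs = [x, y, z]"
    by (auto simp: numeral_3_eq_3 length_Suc_conv)
  have "{x, y, z} \<subseteq> B" "(x, y) \<in> parcs G" "(y, z) \<in> parcs G" "x \<noteq> z"
    using xs no by (auto simp: xyz vpath_def vwalk_def)
  then show False using assms unfolding dissoc_def by blast
qed auto

theorem theorem3:
  fixes G :: "'a pair_pre_digraph" and n :: nat
  assumes "pair_graph G"
    and "outerplanar G"
    and "card (pverts G) = n"
  shows "real (psi 3 G) \<le> real n / 2"
proof -
  obtain pt crv where "outer_drawing G pt crv"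
    using assms(1,2) unfolding outerplanar_def outer_drawing_def by blast
  then interpret outer_drawing G pt crv .
  obtain B where B: "B \<subseteq> pverts G" "dissoc adj B" "n \<le> 2 * card B"
    using ex_dissociation_set assms(3) by blast
  have "path_vertex_cover 3 G (pverts G - B)"
    using path_vertex_cover_3_Diff[OF B(2)] adjD(4) by blast
  then have "psi 3 G \<le> card (pverts G - B)"
    unfolding psi_def by (intro Least_le) blast
  moreover have "card (pverts G - B) = n - card B"
    using B(1) assms(3) finite_subset[OF B(1) finite_pverts] by (simp add: card_Diff_subset)
  ultimately show ?thesis using B(3) by linarith
qed

end
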